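(* Every positive elliptical distribution is partially faithful.
   Context: A random vector $X=(X_1,\dots,X_d)$ has an elliptical distribution, written $X\sim E(\mu,\Sigma)$, if its characteristic function has the form $\boldsymbol t\mapsto \phi(\boldsymbol t^T\Sigma \boldsymbol t)\exp(i\mu^T \boldsymbol t)$ for some $\phi:[0,\infty)\to\mathbb{R}$, where $\mu\in\mathbb{R}^d$ and $\Sigma$ is a $d\times d$ symmetric matrix; $\phi$ is left implicit. Standing assumptions: $\Sigma$ is positive definite and, in the stochastic representation $X=\mu+\xi\,\Sigma^{1/2}U$ with $U$ uniform on the unit sphere of $\mathbb{R}^d$, $\xi\ge 0$ and $\xi$ independent of $U$, one has $0<\mathbb{E}\xi^2<\infty$. Put $V=\{1,\dots,d\}$, $K=\Sigma^{-1}$. $X\sim E(\mu,\Sigma)$ is called positive if all partial correlations $\rho_{ij\cdot V\setminus\{i,j\}}=-K_{ij}/\sqrt{K_{ii}K_{jj}}$, $i\ne j$, are nonnegative (equivalently $K_{ij}\le 0$ for all $i\neq j$). The distribution of $X$ is partially faithful if for all distinct $i,j\in V$ and every $C\subset V\setminus\{i,j\}$: $\operatorname{corr}(X_i,X_j\mid X_C)=0$ implies $\operatorname{corr}(X_i,X_j\mid X_{(ij)})=0$. Here $X_C$ is the subvector with coordinates in $C$ (no conditioning if $C=\emptyset$) and $X_{(ij)}$ is $X$ with the coordinates $X_i,X_j$ removed; in elliptical distributions these conditional correlations do not depend on the value of the conditioning vector. *)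

theory Defs
  imports "HOL-Probability.Probability"
begin

definition symmetric_matrix :: "real^'n^'n \<Rightarrow> bool" where
  "symmetric_matrix S \<longleftrightarrow> transpose S = S"

definition positive_definite :: "real^'n^'n \<Rightarrow> bool" where
  "positive_definite S \<longleftrightarrow> symmetric_matrix S \<and> (\<forall>t. t \<noteq> 0 \<longrightarrow> t \<bullet> (S *v t) > 0)"

(* "is_sqrt_matrix R S" says R = S^(1/2), the symmetric positive definite square root. *)
definition is_sqrt_matrix :: "real^'n^'n \<Rightarrow> real^'n^'n \<Rightarrow> bool" where
  "is_sqrt_matrix R S \<longleftrightarrow> positive_definite R \<and> R ** R = S"

(* X ~ E(mu, S), via the characteristic function. The function phi is used only at the values
   of the quadratic form of S, which lie in [0, \<infinity>) when S is positive definite. *)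
definition elliptical ::
    "'a measure \<Rightarrow> ('a \<Rightarrow> real^'n) \<Rightarrow> real^'n \<Rightarrow> real^'n^'n \<Rightarrow> bool" where
  "elliptical M X \<mu> S \<longleftrightarrow>
     prob_space M \<and> X \<in> borel_measurable M \<and> symmetric_matrix S \<and>
     (\<exists>\<phi> :: real \<Rightarrow> real. \<forall>t.
        (CLINT \<omega>|M. iexp (t \<bullet> X \<omega>)) =
          complex_of_real (\<phi> (t \<bullet> (S *v t))) * iexp (\<mu> \<bullet> t))"

(* Normalised surface measure on the unit sphere, as the cone measure: the image of the uniform
   distribution on the unit ball under sgn x = x /\<^sub>R norm x. For dimension 1 this is the
   uniform distribution on {-1, 1}. *)
definition uniform_sphere :: "(real^'n) measure" where
  "uniform_sphere = distr (uniform_measure lborel (ball 0 1)) borel sgn"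

(* X = mu + xi S^(1/2) U in distribution, with xi and U living on a probability space N that
   may differ from that of X: if xi vanishes with positive probability, the space of X
   need not carry such a U. Independence is spelled out through indep_set because indep_var
   requires both random variables to have the same type. *)
definition stochastic_representation ::
    "'a measure \<Rightarrow> ('a \<Rightarrow> real^'n) \<Rightarrow> real^'n \<Rightarrow> real^'n^'n \<Rightarrow>
     'b measure \<Rightarrow> ('b \<Rightarrow> real) \<Rightarrow> ('b \<Rightarrow> real^'n) \<Rightarrow> bool" where
  "stochastic_representation M X \<mu> S N \<xi> U \<longleftrightarrow>
     prob_space N \<and>
     \<xi> \<in> borel_measurable N \<and> U \<in> borel_measurable N \<and>
     prob_space.indep_set N
       {\<xi> -` A \<inter> space N |A. A \<in> sets borel} {U -` A \<inter> space N |A. A \<in> sets borel} \<and>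
     (AE \<omega> in N. \<xi> \<omega> \<ge> 0) \<and>
     distr N borel U = uniform_sphere \<and>
     (\<exists>R. is_sqrt_matrix R S \<and>
        distr M borel X = distr N borel (\<lambda>\<omega>. \<mu> + \<xi> \<omega> *\<^sub>R (R *v U \<omega>)))"

(* The partial correlation of X_i and X_j given all remaining coordinates, with K = S^(-1). *)
definition partial_correlation :: "real^'n^'n \<Rightarrow> 'n \<Rightarrow> 'n \<Rightarrow> real" where
  "partial_correlation S i j =
     (let K = matrix_inv S in - (K $ i $ j) / sqrt (K $ i $ i * K $ j $ j))"

definition positive_elliptical ::
    "'a measure \<Rightarrow> ('a \<Rightarrow> real^'n) \<Rightarrow> real^'n \<Rightarrow> real^'n^'n \<Rightarrow> bool" where
  "positive_elliptical M X \<mu> S \<longleftrightarrow>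
     elliptical M X \<mu> S \<and> (\<forall>i j. i \<noteq> j \<longrightarrow> partial_correlation S i j \<ge> 0)"

(* The sigma-algebra generated by the subvector X_C; it is trivial for C = {}. *)
definition subvector_algebra ::
    "'a measure \<Rightarrow> ('a \<Rightarrow> real^'n) \<Rightarrow> 'n set \<Rightarrow> 'a measure" where
  "subvector_algebra M X C =
     vimage_algebra (space M) (\<lambda>\<omega>. \<lambda>i\<in>C. X \<omega> $ i) (PiM C (\<lambda>_. borel))"

definition cond_cov ::
    "'a measure \<Rightarrow> 'a measure \<Rightarrow> ('a \<Rightarrow> real) \<Rightarrow> ('a \<Rightarrow> real) \<Rightarrow> 'a \<Rightarrow> real" where
  "cond_cov M F Y Z =
     real_cond_exp M F
       (\<lambda>\<omega>. (Y \<omega> - real_cond_exp M F Y \<omega>) * (Z \<omega> - real_cond_exp M F Z \<omega>))"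

definition cond_corr ::
    "'a measure \<Rightarrow> 'a measure \<Rightarrow> ('a \<Rightarrow> real) \<Rightarrow> ('a \<Rightarrow> real) \<Rightarrow> 'a \<Rightarrow> real" where
  "cond_corr M F Y Z \<omega> =
     cond_cov M F Y Z \<omega> / sqrt (cond_cov M F Y Y \<omega> * cond_cov M F Z Z \<omega>)"

(* corr(X_i, X_j | X_C) = 0, almost surely. Where a conditional variance vanishes (this can
   have positive probability only if xi has an atom at 0) the correlation is undefined;
   by x / 0 = 0 such points impose no condition. *)
definition cond_uncorrelated ::
    "'a measure \<Rightarrow> ('a \<Rightarrow> real^'n) \<Rightarrow> 'n \<Rightarrow> 'n \<Rightarrow> 'n set \<Rightarrow> bool" where
  "cond_uncorrelated M X i j C \<longleftrightarrow>
     (AE \<omega> in M.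
        cond_corr M (subvector_algebra M X C) (\<lambda>\<omega>. X \<omega> $ i) (\<lambda>\<omega>. X \<omega> $ j) \<omega> = 0)"

definition partially_faithful :: "'a measure \<Rightarrow> ('a \<Rightarrow> real^'n) \<Rightarrow> bool" where
  "partially_faithful M X \<longleftrightarrow>
     (\<forall>i j C. i \<noteq> j \<longrightarrow> C \<subseteq> UNIV - {i, j} \<longrightarrow>
        cond_uncorrelated M X i j C \<longrightarrow> cond_uncorrelated M X i j (UNIV - {i, j}))"

end

theory Submission
  imports Defs
begin

text \<open>
  For a set \<open>C\<close> of coordinates and \<open>i \<notin> C\<close>, let \<open>q\<close> be the vector of coefficients of the residual
  of \<open>X\<^sub>i\<close> after linear regression on \<open>X\<^sub>C\<close>, and let \<open>r\<close> be the same for \<open>X\<^sub>j\<close>. The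
  theorem rests on two facts.

  First, \<open>corr(X\<^sub>i, X\<^sub>j | X\<^sub>C) = 0\<close> holds if and only if the number \<open>q \<bullet> (S *v r)\<close>, which is
  proportional to the linear residual covariance, vanishes (\<open>cond_uncorrelated_iff\<close>). Since the uniform distribution on the sphere is
  invariant under orthogonal maps and \<open>\<xi>\<close> is independent of \<open>U\<close>, the law of \<open>X\<close> is invariant
  under every affine reflection that is orthogonal in the metric of \<open>S\<close> inverse
  (\<open>elliptical_reflection\<close>). The reflection attached to \<open>q\<close> fixes \<open>X\<^sub>C\<close> and every linear form that
  is \<open>S\<close>-orthogonal to \<open>q\<close>, and it changes the sign of the residual \<open>q \<bullet> (X - \<mu>)\<close>. Hence the
  residual, and its product with any \<open>S\<close>-orthogonal linear form, have conditional expectation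
  zero given \<open>X\<^sub>C\<close>. The first of these statements identifies the conditional expectation of
  \<open>X\<^sub>i\<close>; the second shows that the conditional covariance is a constant multiple, with the sign of
  \<open>q \<bullet> (S *v r)\<close>, of a conditional variance that is not almost surely zero.

  Second, \<open>K = matrix_inv S\<close> is a positive definite matrix with nonpositive off-diagonal entries.
  The vector \<open>y = S *v r\<close> is supported off \<open>C\<close> and solves there the principal subsystem of \<open>K\<close>
  with right-hand side the \<open>j\<close>-th unit vector, so it is a column of the inverse of an M-matrix and
  is nonnegative (\<open>M_matrix_inverse_nonneg\<close>). If \<open>y\<^sub>i = 0\<close>, then the \<open>i\<close>-th equation states that
  a sum of nonpositive terms is zero; the term \<open>K\<^sub>i\<^sub>j y\<^sub>j\<close> is one of them and \<open>y\<^sub>j > 0\<close>, so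
  \<open>K\<^sub>i\<^sub>j = 0\<close>. For \<open>C\<close> the complement of \<open>{i, j}\<close> the subsystem has two equations only, and
  \<open>K\<^sub>i\<^sub>j = 0\<close> gives \<open>y\<^sub>i = 0\<close> back.
\<close>

section \<open>Residual directions of a positive definite matrix\<close>

lemma positive_definite_inner_commute:
  assumes "positive_definite S"
  shows "x \<bullet> (S *v y) = (S *v x) \<bullet> y"
  using assms unfolding positive_definite_def symmetric_matrix_def
  by (metis dot_lmul_matrix vector_transpose_matrix)

lemma positive_definite_ker:
  assumes "positive_definite S" and "S *v x = 0"
  shows "x = 0"
proof (rule ccontr)
  assume "x \<noteq> 0"
  with assms(1) have "x \<bullet> (S *v x) > 0"
    unfolding positive_definite_def by blast
  with assms(2) show False by simp
qed

lemma positive_definite_inverse: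
  fixes S :: "real^'n^'n"
  assumes "positive_definite S"
  shows matrix_inv_mult_right: "S ** matrix_inv S = mat 1"
    and matrix_inv_mult_left: "matrix_inv S ** S = mat 1"
    and positive_definite_matrix_inv: "positive_definite (matrix_inv S)"
proof -
  have "\<exists>B. B ** S = mat 1"
    using positive_definite_ker[OF assms] unfolding matrix_left_invertible_ker by blast
  then have "\<exists>B. S ** B = mat 1 \<and> B ** S = mat 1"
    using matrix_left_right_inverse by blast
  then show inv: "S ** matrix_inv S = mat 1" "matrix_inv S ** S = mat 1"
    unfolding matrix_inv_def by (metis (mono_tags, lifting) someI_ex)+
  have "transpose (matrix_inv S) = matrix_inv S"
  proof -
    have "transpose (matrix_inv S) ** S = mat 1"
      using assms inv unfolding positive_definite_def symmetric_matrix_def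
      by (metis matrix_transpose_mul transpose_mat)
    then show ?thesis
      by (metis inv(1) matrix_mul_assoc matrix_mul_lid matrix_mul_rid)
  qed
  moreover have "t \<bullet> (matrix_inv S *v t) > 0" if "t \<noteq> 0" for t
  proof -
    let ?u = "matrix_inv S *v t"
    have u: "S *v ?u = t"
      by (simp add: matrix_vector_mul_assoc inv)
    with that have "?u \<noteq> 0"
      by (metis matrix_vector_mult_0_right)
    then have "?u \<bullet> (S *v ?u) > 0"
      using assms unfolding positive_definite_def by blast
    then show ?thesis
      by (simp add: u inner_commute)
  qed
  ultimately show "positive_definite (matrix_inv S)"
    unfolding positive_definite_def symmetric_matrix_def by blast
qed

lemma positive_definite_diagonal_pos:
  assumes "positive_definite K"
  shows "K $ i $ i > 0"
proof -
  have "axis i 1 \<bullet> (K *v axis i 1) > 0"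
    using assms unfolding positive_definite_def by (simp add: axis_eq_0_iff)
  then show ?thesis
    by (simp add: inner_axis' matrix_vector_mult_basis column_def)
qed

text \<open>
  For \<open>i \<notin> C\<close>, the coefficient vector of the residual of the best linear prediction of the
  \<open>i\<close>-th coordinate from those in \<open>C\<close>, when \<open>S\<close> is the covariance matrix: the values \<open>- q $ k\<close>
  for \<open>k \<in> C\<close> are the regression coefficients, and the first condition makes the residual
  uncorrelated with the predictors.
\<close>

definition residual_direction :: "real^'n^'n \<Rightarrow> 'n set \<Rightarrow> 'n \<Rightarrow> real^'n \<Rightarrow> bool" where
  "residual_direction S C i q \<longleftrightarrow>
     (\<forall>k\<in>C. (S *v q) $ k = 0) \<and> (\<forall>k. k \<notin> C \<longrightarrow> q $ k = (if k = i then 1 else 0))"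

text \<open>
  In coordinates transformed by \<open>R\<close> the \<open>S\<close>-inner product becomes the Euclidean one, so the
  residual direction is an orthogonal projection.
\<close>

lemma residual_direction_exists:
  fixes S :: "real^'n^'n"
  assumes R: "is_sqrt_matrix R S" and i: "i \<notin> C"
  obtains q where "residual_direction S C i q"
proof -
  let ?B = "{v :: real^'n. \<forall>k. k \<notin> C \<longrightarrow> v $ k = 0}"
  have "subspace ((*v) R ` ?B)"
    by (intro linear_subspace_image matrix_vector_mul_linear)
       (auto simp: subspace_def)
  then have span: "span ((*v) R ` ?B) = (*v) R ` ?B"
    by (rule span_eq_iff[THEN iffD2])
  obtain y z where y: "y \<in> span ((*v) R ` ?B)"
    and z: "\<And>w. w \<in> span ((*v) R ` ?B) \<Longrightarrow> orthogonal z w"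
    and yz: "R *v axis i 1 = y + z"
    using orthogonal_subspace_decomp_exists[of "(*v) R ` ?B" "R *v axis i 1"] by blast
  from y span obtain b where b: "b \<in> ?B" "y = R *v b"
    by auto
  define q where "q = axis i 1 - b"
  have zq: "z = R *v q"
    using yz b(2) by (simp add: q_def matrix_vector_mult_diff_distrib)
  have "(S *v q) $ k = 0" if "k \<in> C" for k
  proof -
    have "axis k 1 \<in> ?B"
      using that by (auto simp: axis_def)
    then have "z \<bullet> (R *v axis k 1) = 0"
      using z span unfolding orthogonal_def by blast
    then have "(R *v (R *v q)) \<bullet> axis k 1 = 0"
      using R positive_definite_inner_commute[of R] unfolding is_sqrt_matrix_def zq by metis
    then show ?thesis
      using R unfolding is_sqrt_matrix_def by (simp add: matrix_vector_mul_assoc inner_axis)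
  qed
  moreover have "q $ k = (if k = i then 1 else 0)" if "k \<notin> C" for k
    using that b(1) by (simp add: q_def axis_def)
  ultimately show ?thesis
    using that unfolding residual_direction_def by blast
qed

text \<open>
  On \<open>C\<close> the vector \<open>S *v r\<close> vanishes, and off \<open>C\<close> the vector \<open>q\<close> is the \<open>i\<close>-th unit vector.
  This turns residual covariances into single entries of \<open>S *v r\<close>.
\<close>

lemma residual_direction_inner:
  assumes "residual_direction S C i q" and "i \<notin> C" and "residual_direction S C j r"
  shows "q \<bullet> (S *v r) = (S *v r) $ i"
proof -
  have "q \<bullet> (S *v r) = (\<Sum>k\<in>UNIV. if k = i then (S *v r) $ i else 0)"
    unfolding inner_vec_def
    by (rule sum.cong) (use assms in \<open>auto simp: residual_direction_def\<close>)
  then show ?thesis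
    by simp
qed

lemma residual_direction_nonzero:
  assumes "residual_direction S C i q" and "i \<notin> C"
  shows "q \<noteq> 0"
  using assms unfolding residual_direction_def by auto

section \<open>Vanishing residual covariances of inverse M-matrices\<close>

text \<open>
  Pair \<open>K *v y\<close> with the negative part \<open>m\<close> of \<open>y\<close>. The supports of \<open>m\<close> and of the positive part
  are disjoint, so only off-diagonal entries of \<open>K\<close> occur between them and \<open>m \<bullet> (K *v m) \<le> 0\<close>
  follows; definiteness makes \<open>m\<close> zero.
\<close>

lemma M_matrix_inverse_nonneg:
  fixes K :: "real^'n^'n" and y :: "real^'n"
  assumes K: "positive_definite K"
    and off: "\<And>i j. i \<noteq> j \<Longrightarrow> K $ i $ j \<le> 0"
    and y: "\<And>k. k \<in> C \<Longrightarrow> y $ k = 0"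
    and Ky: "\<And>k. k \<notin> C \<Longrightarrow> (K *v y) $ k \<ge> 0"
  shows "y $ k \<ge> 0"
proof -
  define m where "m = (\<chi> k. max (- (y $ k)) 0)"
  define p where "p = (\<chi> k. max (y $ k) 0)"
  have ypm: "y = p - m"
    by (auto simp: vec_eq_iff p_def m_def max_def)
  have "m \<bullet> (K *v y) \<ge> 0"
    unfolding inner_vec_def
  proof (rule sum_nonneg)
    fix k
    show "m $ k \<bullet> (K *v y) $ k \<ge> 0"
      using y[of k] Ky[of k] by (cases "k \<in> C") (auto simp: m_def)
  qed
  moreover have "m \<bullet> (K *v p) \<le> 0"
    unfolding inner_vec_def matrix_vector_mult_def
  proof (rule sum_nonpos)
    fix k
    have "(\<Sum>l\<in>UNIV. m $ k * (K $ k $ l * p $ l)) \<le> 0"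
    proof (rule sum_nonpos)
      fix l
      show "m $ k * (K $ k $ l * p $ l) \<le> 0"
      proof (cases "k = l")
        case True
        then have "m $ k = 0 \<or> p $ l = 0"
          by (auto simp: m_def p_def)
        then show ?thesis by auto
      next
        case False
        have "m $ k \<ge> 0" "p $ l \<ge> 0"
          by (auto simp: m_def p_def)
        then show ?thesis
          using off[OF False] by (simp add: mult_nonneg_nonpos mult_nonpos_nonneg)
      qed
    qed
    then show "m $ k \<bullet> (\<chi> i. \<Sum>j\<in>UNIV. K $ i $ j * p $ j) $ k \<le> 0"
      by (simp add: sum_distrib_left)
  qed
  ultimately have "m \<bullet> (K *v m) \<le> 0"
    unfolding ypm by (simp add: matrix_vector_mult_diff_distrib inner_diff_right)
  then have "m = 0"
    using K unfolding positive_definite_def by (meson not_le)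
  then have "m $ k = 0" by simp
  then show ?thesis
    by (simp add: m_def max_def split: if_splits)
qed

text \<open>
  This is the place where positivity of the distribution is used: the \<open>i\<close>-th entry of \<open>K *v y\<close>,
  with \<open>y = S *v q\<close> nonnegative, contains no positive term once \<open>y $ i = 0\<close>, so it can vanish only
  if every term does.
\<close>

lemma residual_covariance_zero_imp_precision_zero:
  fixes S :: "real^'n^'n"
  assumes S: "positive_definite S"
    and off: "\<And>i j. i \<noteq> j \<Longrightarrow> matrix_inv S $ i $ j \<le> 0"
    and q: "residual_direction S C j q" and C: "i \<notin> C" "j \<notin> C" "i \<noteq> j"
    and zero: "(S *v q) $ i = 0"
  shows "matrix_inv S $ i $ j = 0"
proof -
  define K where "K = matrix_inv S"
  define y where "y = S *v q"
  have Ky: "K *v y = q"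
    by (simp add: y_def K_def matrix_vector_mul_assoc matrix_inv_mult_left[OF S])
  have yC: "y $ k = 0" if "k \<in> C" for k
    using q that unfolding residual_direction_def y_def by blast
  have y0: "y $ k \<ge> 0" for k
  proof (rule M_matrix_inverse_nonneg[where K = K and C = C])
    show "positive_definite K"
      unfolding K_def by (rule positive_definite_matrix_inv[OF S])
    show "(K *v y) $ k \<ge> 0" if "k \<notin> C" for k
      using q that unfolding Ky residual_direction_def by simp
  qed (use off yC in \<open>auto simp: K_def\<close>)
  have yj: "y $ j > 0"
    using residual_direction_inner[OF q C(2) q] residual_direction_nonzero[OF q C(2)] S
    unfolding y_def positive_definite_def by metis
  have nonpos: "K $ i $ k * y $ k \<le> 0" for k
    using off[of i k] y0[of k] zero
    by (cases "k = i") (auto simp: K_def y_def mult_nonpos_nonneg)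
  have "(\<Sum>k\<in>UNIV. - (K $ i $ k * y $ k)) = - ((K *v y) $ i)"
    by (simp add: matrix_vector_mult_def sum_negf)
  also have "\<dots> = 0"
    using q C unfolding Ky residual_direction_def by auto
  finally have "- (K $ i $ j * y $ j) = 0"
    using nonpos by (subst (asm) sum_nonneg_eq_0_iff) auto
  then show ?thesis
    using yj by (simp add: K_def)
qed

lemma precision_zero_imp_residual_covariance_zero:
  fixes S :: "real^'n^'n"
  assumes S: "positive_definite S"
    and q: "residual_direction S (UNIV - {i, j}) j q" and ij: "i \<noteq> j"
    and zero: "matrix_inv S $ i $ j = 0"
  shows "(S *v q) $ i = 0"
proof -
  define K where "K = matrix_inv S"
  define y where "y = S *v q"
  have "(K *v y) $ i = q $ i"
    by (simp add: y_def K_def matrix_vector_mul_assoc matrix_inv_mult_left[OF S])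
  also have "\<dots> = 0"
    using q ij unfolding residual_direction_def by auto
  finally have "(K *v y) $ i = 0" .
  moreover have "(K *v y) $ i = (\<Sum>k\<in>UNIV. if k = i then K $ i $ i * y $ i else 0)"
    unfolding matrix_vector_mult_def vec_lambda_beta
  proof (rule sum.cong)
    fix k
    show "K $ i $ k * y $ k = (if k = i then K $ i $ i * y $ i else 0)"
      using q zero by (cases "k = j") (auto simp: K_def y_def residual_direction_def)
  qed simp
  ultimately have "K $ i $ i * y $ i = 0"
    by simp
  moreover have "K $ i $ i > 0"
    unfolding K_def using positive_definite_diagonal_pos positive_definite_matrix_inv[OF S] by blast
  ultimately show ?thesis
    by (simp add: y_def)
qed

lemma partial_correlation_nonneg_imp:
  assumes S: "positive_definite S" and "partial_correlation S i j \<ge> 0"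
  shows "matrix_inv S $ i $ j \<le> 0"
proof -
  have "matrix_inv S $ i $ i > 0" "matrix_inv S $ j $ j > 0"
    using positive_definite_diagonal_pos positive_definite_matrix_inv[OF S] by blast+
  then have "sqrt (matrix_inv S $ i $ i * matrix_inv S $ j $ j) > 0" (is "?s > 0")
    by simp
  moreover have "0 \<le> - (matrix_inv S $ i $ j) / ?s"
    using assms(2) unfolding partial_correlation_def Let_def .
  ultimately show ?thesis
    unfolding zero_le_divide_iff by linarith
qed

section \<open>Laws that are invariant under reflections\<close>

text \<open>
  For invertible symmetric \<open>R\<close> with \<open>R ** R = S\<close>, the map \<open>y \<mapsto> \<mu> + R y\<close> conjugates this to the
  Euclidean reflection in the hyperplane orthogonal to \<open>R *v q\<close>; written in terms of \<open>S\<close> alone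
  the root disappears. For positive definite \<open>S\<close> and \<open>q = 0\<close> it is the identity.
\<close>

definition covariance_reflection :: "real^'n \<Rightarrow> real^'n^'n \<Rightarrow> real^'n \<Rightarrow> real^'n \<Rightarrow> real^'n" where
  "covariance_reflection \<mu> S q x = x - (2 * (q \<bullet> (x - \<mu>)) / (q \<bullet> (S *v q))) *\<^sub>R (S *v q)"

lemma covariance_reflection_measurable [measurable]:
  "covariance_reflection \<mu> S q \<in> borel_measurable borel"
  unfolding covariance_reflection_def by measurable

lemma inner_covariance_reflection:
  "r \<bullet> (covariance_reflection \<mu> S q x - \<mu>) =
     r \<bullet> (x - \<mu>) - 2 * (q \<bullet> (x - \<mu>)) / (q \<bullet> (S *v q)) * (r \<bullet> (S *v q))"
  by (simp add: covariance_reflection_def inner_diff_right)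

text \<open>
  The properties of an elliptical vector that determine when its conditional correlations vanish,
  freed from the stochastic representation.
\<close>

locale reflection_invariant = prob_space M for M :: "'a measure" +
  fixes X :: "'a \<Rightarrow> real^'n" and \<mu> :: "real^'n" and S :: "real^'n^'n"
  assumes X_measurable [measurable]: "X \<in> borel_measurable M"
    and positive_definite_S: "positive_definite S"
    and square_integrable: "integrable M (\<lambda>\<omega>. (norm (X \<omega> - \<mu>))\<^sup>2)"
    and reflection: "distr M borel (\<lambda>\<omega>. covariance_reflection \<mu> S q (X \<omega>)) = distr M borel X"
    and nondegenerate: "q \<noteq> 0 \<Longrightarrow> \<not> (AE \<omega> in M. q \<bullet> (X \<omega> - \<mu>) = 0)"
begin

lemma quadratic_pos: "q \<noteq> 0 \<Longrightarrow> q \<bullet> (S *v q) > 0"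
  using positive_definite_S unfolding positive_definite_def by blast

lemma inner_reflection_same:
  "q \<bullet> (covariance_reflection \<mu> S q x - \<mu>) = - (q \<bullet> (x - \<mu>))"
  using quadratic_pos[of q] by (cases "q = 0") (auto simp: inner_covariance_reflection)

lemma inner_reflection_orthogonal:
  assumes "r \<bullet> (S *v q) = 0"
  shows "r \<bullet> (covariance_reflection \<mu> S q x - \<mu>) = r \<bullet> (x - \<mu>)"
  using assms by (simp add: inner_covariance_reflection)

lemma expectation_odd_zero:
  fixes G :: "real^'n \<Rightarrow> real"
  assumes [measurable]: "G \<in> borel_measurable borel"
    and odd: "\<And>x. G (covariance_reflection \<mu> S q x) = - G x"
  shows "expectation (\<lambda>\<omega>. G (X \<omega>)) = 0"
proof -
  have "expectation (\<lambda>\<omega>. G (X \<omega>)) = integral\<^sup>L (distr M borel X) G"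
    by (simp add: integral_distr)
  also have "\<dots> = integral\<^sup>L (distr M borel (\<lambda>\<omega>. covariance_reflection \<mu> S q (X \<omega>))) G"
    by (simp add: reflection)
  also have "\<dots> = expectation (\<lambda>\<omega>. G (covariance_reflection \<mu> S q (X \<omega>)))"
    by (subst integral_distr) simp_all
  also have "\<dots> = - expectation (\<lambda>\<omega>. G (X \<omega>))"
    by (simp add: odd)
  finally show ?thesis
    by simp
qed

lemma coordinate_measurable [measurable]: "(\<lambda>\<omega>. X \<omega> $ k) \<in> borel_measurable M"
  by (rule measurable_compose[OF X_measurable]) measurable

lemma coordinate_vector_measurable:
  "(\<lambda>x::real^'n. \<lambda>k\<in>C. x $ k) \<in> borel \<rightarrow>\<^sub>M PiM C (\<lambda>_. borel :: real measure)"
  by measurable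

lemma subalgebra_subvector: "subalgebra M (subvector_algebra M X C)"
proof -
  have "(\<lambda>\<omega>. \<lambda>k\<in>C. X \<omega> $ k) \<in> M \<rightarrow>\<^sub>M PiM C (\<lambda>_. borel :: real measure)"
    by measurable
  then have "sets (subvector_algebra M X C) \<subseteq> sets M"
    unfolding subvector_algebra_def
    by (subst sets_vimage_algebra2) (auto simp: space_PiM intro!: measurable_sets)
  then show ?thesis
    by (simp add: subalgebra_def subvector_algebra_def)
qed

lemma sigma_finite_subvector: "sigma_finite_subalgebra M (subvector_algebra M X C)"
  by (intro finite_measure_subalgebra_is_sigma_finite finite_measure_subalgebra.intro
        finite_measure_subalgebra_axioms.intro subalgebra_subvector finite_measure_axioms)

lemma coordinate_subvector_measurable:
  assumes "k \<in> C"
  shows "(\<lambda>\<omega>. X \<omega> $ k) \<in> borel_measurable (subvector_algebra M X C)"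
proof -
  let ?f = "\<lambda>\<omega>. \<lambda>k\<in>C. X \<omega> $ k"
  have "?f \<in> subvector_algebra M X C \<rightarrow>\<^sub>M PiM C (\<lambda>_. borel :: real measure)"
    unfolding subvector_algebra_def by (rule measurable_vimage_algebra1) (auto simp: space_PiM)
  then have "(\<lambda>\<omega>. ?f \<omega> k) \<in> borel_measurable (subvector_algebra M X C)"
    using measurable_component_singleton[OF assms] by (rule measurable_compose)
  then show ?thesis
    using assms by simp
qed

text \<open>
  A reflection whose direction \<open>S *v q\<close> vanishes on \<open>C\<close> does not move the coordinates in \<open>C\<close>. So the
  indicator of an event determined by these coordinates is invariant, its product with \<open>G\<close> is odd,
  and the integral of \<open>G\<close> over the event vanishes.
\<close>

lemma cond_exp_odd_zero:
  fixes G :: "real^'n \<Rightarrow> real"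
  assumes G [measurable]: "G \<in> borel_measurable borel"
    and int: "integrable M (\<lambda>\<omega>. G (X \<omega>))"
    and odd: "\<And>x. G (covariance_reflection \<mu> S q x) = - G x"
    and fixed: "\<And>k. k \<in> C \<Longrightarrow> (S *v q) $ k = 0"
  shows "AE \<omega> in M. real_cond_exp M (subvector_algebra M X C) (\<lambda>\<omega>. G (X \<omega>)) \<omega> = 0"
proof -
  interpret F: sigma_finite_subalgebra M "subvector_algebra M X C"
    by (rule sigma_finite_subvector)
  show ?thesis
  proof (rule F.real_cond_exp_charact[where g = "\<lambda>_. 0"])
    fix A assume "A \<in> sets (subvector_algebra M X C)"
    then obtain B where B [measurable]: "B \<in> sets (PiM C (\<lambda>_. borel :: real measure))"
      and A: "A = (\<lambda>\<omega>. \<lambda>k\<in>C. X \<omega> $ k) -` B \<inter> space M"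
      unfolding subvector_algebra_def
      by (subst (asm) sets_vimage_algebra2) (auto simp: space_PiM)
    let ?H = "\<lambda>x. indicator B (\<lambda>k\<in>C. x $ k) * G x"
    have [measurable]: "(\<lambda>x::real^'n. \<lambda>k\<in>C. x $ k) \<in> borel \<rightarrow>\<^sub>M PiM C (\<lambda>_. borel :: real measure)"
      by (rule coordinate_vector_measurable)
    have "(\<integral>\<omega>\<in>A. G (X \<omega>) \<partial>M) = expectation (\<lambda>\<omega>. ?H (X \<omega>))"
      unfolding set_lebesgue_integral_def
      by (rule Bochner_Integration.integral_cong) (auto simp: A indicator_def)
    also have "\<dots> = 0"
    proof (rule expectation_odd_zero[where q = q])
      show "?H \<in> borel_measurable borel"
        by measurable
      fix x
      have "(\<lambda>k\<in>C. covariance_reflection \<mu> S q x $ k) = (\<lambda>k\<in>C. x $ k)"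
        by (auto simp: covariance_reflection_def fixed restrict_def)
      then show "?H (covariance_reflection \<mu> S q x) = - ?H x"
        by (simp add: odd)
    qed
    finally show "(\<integral>\<omega>\<in>A. G (X \<omega>) \<partial>M) = (\<integral>\<omega>\<in>A. 0 \<partial>M)"
      by (simp add: set_lebesgue_integral_def)
  qed (use int in auto)
qed

lemma integrable_inner_product:
  "integrable M (\<lambda>\<omega>. (q \<bullet> (X \<omega> - \<mu>)) * (r \<bullet> (X \<omega> - \<mu>)))"
proof (rule Bochner_Integration.integrable_bound)
  show "integrable M (\<lambda>\<omega>. (norm q * norm r) * (norm (X \<omega> - \<mu>))\<^sup>2)"
    using square_integrable by simp
  show "AE \<omega> in M. norm ((q \<bullet> (X \<omega> - \<mu>)) * (r \<bullet> (X \<omega> - \<mu>)))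
      \<le> norm ((norm q * norm r) * (norm (X \<omega> - \<mu>))\<^sup>2)"
  proof (rule AE_I2)
    fix \<omega>
    have "\<bar>q \<bullet> (X \<omega> - \<mu>)\<bar> * \<bar>r \<bullet> (X \<omega> - \<mu>)\<bar>
        \<le> (norm q * norm (X \<omega> - \<mu>)) * (norm r * norm (X \<omega> - \<mu>))"
      by (intro mult_mono Cauchy_Schwarz_ineq2) auto
    then show "norm ((q \<bullet> (X \<omega> - \<mu>)) * (r \<bullet> (X \<omega> - \<mu>)))
      \<le> norm ((norm q * norm r) * (norm (X \<omega> - \<mu>))\<^sup>2)"
      by (simp add: abs_mult power2_eq_square ac_simps)
  qed
qed measurable

lemma integrable_inner: "integrable M (\<lambda>\<omega>. q \<bullet> (X \<omega> - \<mu>))"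
proof (rule square_integrable_imp_integrable)
  show "integrable M (\<lambda>\<omega>. (q \<bullet> (X \<omega> - \<mu>))\<^sup>2)"
    unfolding power2_eq_square by (rule integrable_inner_product)
qed measurable

text \<open>
  \<open>X\<^sub>i\<close> is the sum of an affine function of \<open>X\<^sub>C\<close> and of \<open>q \<bullet> (X - \<mu>)\<close>; the latter is odd under
  the reflection attached to \<open>q\<close>, so the conditional expectation of \<open>X\<^sub>i\<close> is the affine part.
\<close>

lemma residual_eq:
  assumes q: "residual_direction S C i q" and i: "i \<notin> C"
  shows "AE \<omega> in M. X \<omega> $ i - real_cond_exp M (subvector_algebra M X C) (\<lambda>\<omega>. X \<omega> $ i) \<omega>
           = q \<bullet> (X \<omega> - \<mu>)"
proof -
  let ?F = "subvector_algebra M X C"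
  interpret F: sigma_finite_subalgebra M ?F
    by (rule sigma_finite_subvector)
  define c where "c = (\<lambda>\<omega>. \<mu> $ i - (\<Sum>k\<in>C. q $ k * (X \<omega> $ k - \<mu> $ k)))"
  have split: "q \<bullet> v = v $ i + (\<Sum>k\<in>C. q $ k * v $ k)" for v
  proof -
    have "q \<bullet> v = (\<Sum>k\<in>UNIV. (if k = i then v $ i else 0) + (if k \<in> C then q $ k * v $ k else 0))"
      unfolding inner_vec_def
      by (rule sum.cong) (use q i in \<open>auto simp: residual_direction_def\<close>)
    then show ?thesis
      by (simp add: sum.distrib sum.If_cases)
  qed
  have X_eq: "X \<omega> $ i = c \<omega> + q \<bullet> (X \<omega> - \<mu>)" for \<omega>
    by (simp add: split c_def)
  have c_meas: "c \<in> borel_measurable ?F"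
    unfolding c_def
    by (intro borel_measurable_diff borel_measurable_sum borel_measurable_times
        borel_measurable_const coordinate_subvector_measurable)
  have "integrable M (\<lambda>\<omega>. axis k 1 \<bullet> (X \<omega> - \<mu>))" for k
    by (rule integrable_inner)
  then have c_int: "integrable M c"
    unfolding c_def by (simp add: inner_axis')
  have "AE \<omega> in M. real_cond_exp M ?F (\<lambda>\<omega>. c \<omega> + q \<bullet> (X \<omega> - \<mu>)) \<omega>
      = real_cond_exp M ?F c \<omega> + real_cond_exp M ?F (\<lambda>\<omega>. q \<bullet> (X \<omega> - \<mu>)) \<omega>"
    by (intro F.real_cond_exp_add c_int integrable_inner)
  moreover have "AE \<omega> in M. real_cond_exp M ?F c \<omega> = c \<omega>"
    by (intro F.real_cond_exp_F_meas c_int c_meas)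
  moreover have "AE \<omega> in M. real_cond_exp M ?F (\<lambda>\<omega>. q \<bullet> (X \<omega> - \<mu>)) \<omega> = 0"
    by (rule cond_exp_odd_zero[where q = q and G = "\<lambda>x. q \<bullet> (x - \<mu>)"])
       (use q in \<open>auto simp: inner_reflection_same integrable_inner residual_direction_def\<close>)
  ultimately show ?thesis
    unfolding X_eq by eventually_elim simp
qed

lemma cond_cov_eq:
  assumes q: "residual_direction S C i q" and i: "i \<notin> C"
    and r: "residual_direction S C j r" and j: "j \<notin> C"
  shows "AE \<omega> in M. cond_cov M (subvector_algebra M X C) (\<lambda>\<omega>. X \<omega> $ i) (\<lambda>\<omega>. X \<omega> $ j) \<omega>
           = real_cond_exp M (subvector_algebra M X C)
               (\<lambda>\<omega>. (q \<bullet> (X \<omega> - \<mu>)) * (r \<bullet> (X \<omega> - \<mu>))) \<omega>"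
proof -
  interpret F: sigma_finite_subalgebra M "subvector_algebra M X C"
    by (rule sigma_finite_subvector)
  show ?thesis
    unfolding cond_cov_def
  proof (rule F.real_cond_exp_cong)
    show "AE \<omega> in M.
        (X \<omega> $ i - real_cond_exp M (subvector_algebra M X C) (\<lambda>\<omega>. X \<omega> $ i) \<omega>) *
        (X \<omega> $ j - real_cond_exp M (subvector_algebra M X C) (\<lambda>\<omega>. X \<omega> $ j) \<omega>)
        = (q \<bullet> (X \<omega> - \<mu>)) * (r \<bullet> (X \<omega> - \<mu>))"
      using residual_eq[OF q i] residual_eq[OF r j] by eventually_elim simp
  qed measurable
qed

text \<open>
  Split the direction \<open>r\<close> into a multiple of \<open>q\<close> and an \<open>S\<close>-orthogonal part \<open>p\<close>. The
  reflection attached to \<open>q\<close> fixes \<open>p \<bullet> (X - \<mu>)\<close> and negates \<open>q \<bullet> (X - \<mu>)\<close>, so their product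
  contributes nothing.
\<close>

lemma cond_cov_proportional:
  assumes q: "residual_direction S C i q" and i: "i \<notin> C"
    and r: "residual_direction S C j r" and j: "j \<notin> C"
  shows "AE \<omega> in M. cond_cov M (subvector_algebra M X C) (\<lambda>\<omega>. X \<omega> $ i) (\<lambda>\<omega>. X \<omega> $ j) \<omega>
           = r \<bullet> (S *v q) / (q \<bullet> (S *v q)) *
             cond_cov M (subvector_algebra M X C) (\<lambda>\<omega>. X \<omega> $ i) (\<lambda>\<omega>. X \<omega> $ i) \<omega>"
proof -
  let ?F = "subvector_algebra M X C"
  interpret F: sigma_finite_subalgebra M ?F
    by (rule sigma_finite_subvector)
  define c where "c = r \<bullet> (S *v q) / (q \<bullet> (S *v q))"
  define p where "p = r - c *\<^sub>R q"
  have p: "p \<bullet> (S *v q) = 0"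
    using quadratic_pos[OF residual_direction_nonzero[OF q i]]
    by (simp add: p_def c_def inner_diff_left)
  have "AE \<omega> in M. real_cond_exp M ?F (\<lambda>\<omega>. (q \<bullet> (X \<omega> - \<mu>)) * (p \<bullet> (X \<omega> - \<mu>))) \<omega> = 0"
    by (rule cond_exp_odd_zero[where q = q and G = "\<lambda>x. (q \<bullet> (x - \<mu>)) * (p \<bullet> (x - \<mu>))"])
       (use q in \<open>auto simp: inner_reflection_same inner_reflection_orthogonal[OF p]
          integrable_inner_product residual_direction_def\<close>)
  moreover have "AE \<omega> in M. real_cond_exp M ?F
      (\<lambda>\<omega>. (q \<bullet> (X \<omega> - \<mu>)) * (p \<bullet> (X \<omega> - \<mu>)) + c * ((q \<bullet> (X \<omega> - \<mu>)) * (q \<bullet> (X \<omega> - \<mu>)))) \<omega>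
      = real_cond_exp M ?F (\<lambda>\<omega>. (q \<bullet> (X \<omega> - \<mu>)) * (p \<bullet> (X \<omega> - \<mu>))) \<omega>
        + real_cond_exp M ?F (\<lambda>\<omega>. c * ((q \<bullet> (X \<omega> - \<mu>)) * (q \<bullet> (X \<omega> - \<mu>)))) \<omega>"
    by (intro F.real_cond_exp_add integrable_mult_right integrable_inner_product)
  moreover have "AE \<omega> in M. real_cond_exp M ?F (\<lambda>\<omega>. c * ((q \<bullet> (X \<omega> - \<mu>)) * (q \<bullet> (X \<omega> - \<mu>)))) \<omega>
      = c * real_cond_exp M ?F (\<lambda>\<omega>. (q \<bullet> (X \<omega> - \<mu>)) * (q \<bullet> (X \<omega> - \<mu>))) \<omega>"
    by (intro F.real_cond_exp_cmult integrable_inner_product)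
  moreover have "(\<lambda>\<omega>. (q \<bullet> (X \<omega> - \<mu>)) * (p \<bullet> (X \<omega> - \<mu>)) + c * ((q \<bullet> (X \<omega> - \<mu>)) * (q \<bullet> (X \<omega> - \<mu>))))
      = (\<lambda>\<omega>. (q \<bullet> (X \<omega> - \<mu>)) * (r \<bullet> (X \<omega> - \<mu>)))"
    by (simp add: fun_eq_iff p_def inner_diff_left algebra_simps)
  ultimately have "AE \<omega> in M. real_cond_exp M ?F (\<lambda>\<omega>. (q \<bullet> (X \<omega> - \<mu>)) * (r \<bullet> (X \<omega> - \<mu>))) \<omega>
      = c * real_cond_exp M ?F (\<lambda>\<omega>. (q \<bullet> (X \<omega> - \<mu>)) * (q \<bullet> (X \<omega> - \<mu>))) \<omega>"
    by (simp only:) (elim eventually_rev_mp; simp)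
  then show ?thesis
    using cond_cov_eq[OF q i r j] cond_cov_eq[OF q i q i] unfolding c_def
    by eventually_elim simp
qed

lemma cond_var_not_AE_zero:
  assumes q: "residual_direction S C i q" and i: "i \<notin> C"
  shows "\<not> (AE \<omega> in M. cond_cov M (subvector_algebra M X C) (\<lambda>\<omega>. X \<omega> $ i) (\<lambda>\<omega>. X \<omega> $ i) \<omega> = 0)"
proof
  let ?F = "subvector_algebra M X C"
  let ?e = "\<lambda>\<omega>. (q \<bullet> (X \<omega> - \<mu>)) * (q \<bullet> (X \<omega> - \<mu>))"
  interpret F: sigma_finite_subalgebra M ?F
    by (rule sigma_finite_subvector)
  assume "AE \<omega> in M. cond_cov M ?F (\<lambda>\<omega>. X \<omega> $ i) (\<lambda>\<omega>. X \<omega> $ i) \<omega> = 0"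
  with cond_cov_eq[OF q i q i] have "AE \<omega> in M. real_cond_exp M ?F ?e \<omega> = 0"
    by eventually_elim simp
  then have "expectation (real_cond_exp M ?F ?e) = 0"
    by (rule integral_eq_zero_AE)
  then have "expectation ?e = 0"
    using F.real_cond_exp_int(2)[OF integrable_inner_product] by simp
  then have "AE \<omega> in M. ?e \<omega> = 0"
    by (subst (asm) integral_nonneg_eq_0_iff_AE) (auto intro: integrable_inner_product)
  then show False
    using nondegenerate[OF residual_direction_nonzero[OF q i]] by simp
qed

text \<open>
  If \<open>q \<bullet> (S *v r)\<close> is not zero, then the conditional covariance is a nonzero multiple of each of
  the two conditional variances. So wherever the correlation is zero, including the points where
  it is zero only because its denominator vanishes, both variances are zero; this
  cannot happen almost surely.
\<close>

lemma cond_uncorrelated_iff: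
  assumes q: "residual_direction S C i q" and i: "i \<notin> C"
    and r: "residual_direction S C j r" and j: "j \<notin> C"
  shows "cond_uncorrelated M X i j C \<longleftrightarrow> q \<bullet> (S *v r) = 0"
proof -
  let ?cov = "\<lambda>i j. cond_cov M (subvector_algebra M X C) (\<lambda>\<omega>. X \<omega> $ i) (\<lambda>\<omega>. X \<omega> $ j)"
  have commute: "r \<bullet> (S *v q) = q \<bullet> (S *v r)"
    using positive_definite_inner_commute[OF positive_definite_S, of r q] by (simp add: inner_commute)
  have cov_commute: "?cov j i = ?cov i j"
    by (simp add: cond_cov_def mult.commute)
  have i_eq: "AE \<omega> in M. ?cov i j \<omega> = q \<bullet> (S *v r) / (q \<bullet> (S *v q)) * ?cov i i \<omega>"
    using cond_cov_proportional[OF q i r j] by (simp only: commute)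
  have j_eq: "AE \<omega> in M. ?cov i j \<omega> = q \<bullet> (S *v r) / (r \<bullet> (S *v r)) * ?cov j j \<omega>"
    using cond_cov_proportional[OF r j q i] by (simp only: cov_commute)
  have pos: "q \<bullet> (S *v q) > 0" "r \<bullet> (S *v r) > 0"
    by (intro quadratic_pos residual_direction_nonzero[OF q i] residual_direction_nonzero[OF r j])+
  show ?thesis
  proof
    assume "q \<bullet> (S *v r) = 0"
    then show "cond_uncorrelated M X i j C"
      using i_eq unfolding cond_uncorrelated_def cond_corr_def
      by (simp only:) (elim eventually_mono, simp)
  next
    assume "cond_uncorrelated M X i j C"
    then have zero: "AE \<omega> in M. ?cov i j \<omega> / sqrt (?cov i i \<omega> * ?cov j j \<omega>) = 0"
      unfolding cond_uncorrelated_def cond_corr_def .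
    show "q \<bullet> (S *v r) = 0"
    proof (rule ccontr)
      assume "q \<bullet> (S *v r) \<noteq> 0"
      then have "AE \<omega> in M. ?cov i i \<omega> = 0"
        using zero i_eq j_eq pos by (elim eventually_rev_mp) auto
      then show False
        using cond_var_not_AE_zero[OF q i] by blast
    qed
  qed
qed

end

section \<open>Elliptical vectors are reflection invariant\<close>

lemma matrix_vector_measurable [measurable (raw)]:
  fixes R :: "real^'n^'m"
  assumes "f \<in> borel_measurable M"
  shows "(\<lambda>x. R *v f x) \<in> borel_measurable M"
proof -
  have "(*v) R \<in> borel_measurable borel"
    by (intro borel_measurable_continuous_onI) (simp add: linear_continuous_on linear_linear)
  then show ?thesis
    using assms by (rule measurable_compose_rev)
qed

lemma orthogonal_transformation_measurable:
  fixes f :: "'a::euclidean_space \<Rightarrow> 'a"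
  assumes "orthogonal_transformation f"
  shows "f \<in> borel_measurable borel"
  using assms by (intro borel_measurable_continuous_onI)
    (simp add: linear_continuous_on linear_linear orthogonal_transformation_linear)

lemma emeasure_unit_ball:
  shows emeasure_unit_ball_nonzero: "emeasure lborel (ball (0::'a::euclidean_space) 1) \<noteq> 0"
    and emeasure_unit_ball_finite: "emeasure lborel (ball (0::'a) 1) < \<infinity>"
proof -
  show "emeasure lborel (ball (0::'a) 1) \<noteq> 0"
    using content_ball_pos[of 1 "0::'a"]
    by (metis enn2real_0 less_irrefl measure_def zero_less_one)
qed (rule emeasure_lborel_ball_finite)

text \<open>
  Uniqueness of translation-invariant measures. The image measure \<open>\<nu>\<close> of the Lebesgue measure \<open>\<lambda>\<close>
  is translation invariant because \<open>f\<close> is linear and onto. Evaluating the double integral of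
  \<open>indicator A x * indicator B (x - y)\<close> over \<open>\<nu> \<Otimes> \<lambda>\<close>, as it stands and after the shift of \<open>x\<close> by \<open>y\<close>,
  gives \<open>\<nu> A * \<lambda> B = \<lambda> A * \<nu> B\<close>, and for the unit ball \<open>B\<close>, which \<open>f\<close> preserves, \<open>\<nu> B = \<lambda> B\<close> is finite and
  positive.
\<close>

lemma lborel_distr_orthogonal:
  fixes f :: "'a::euclidean_space \<Rightarrow> 'a"
  assumes f: "orthogonal_transformation f"
  shows "distr lborel borel f = lborel"
proof (rule measure_eqI)
  define \<nu> where "\<nu> = distr lborel borel f"
  let ?B = "ball (0::'a) 1"
  have [measurable]: "?B \<in> sets borel"
    by simp
  have sets_nu [simp, measurable_cong]: "sets \<nu> = sets borel"
    by (simp add: \<nu>_def)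
  have f_meas [measurable]: "f \<in> borel_measurable borel"
    by (rule orthogonal_transformation_measurable[OF f])
  have inv_meas [measurable]: "inv f \<in> borel_measurable borel"
    by (intro orthogonal_transformation_measurable orthogonal_transformation_inv f)
  \<comment> \<open>sigma-finiteness of \<open>\<nu>\<close> is inherited from its image under the inverse of \<open>f\<close>\<close>
  have "distr \<nu> borel (inv f) = distr lborel borel (inv f \<circ> f)"
    unfolding \<nu>_def by (rule distr_distr) measurable
  also have "\<dots> = distr lborel lborel (\<lambda>x. x)"
    by (rule distr_cong) (simp_all add: orthogonal_transformation_inj[OF f])
  finally have "distr \<nu> borel (inv f) = lborel"
    by (simp add: distr_id)
  then have "sigma_finite_measure (distr \<nu> borel (inv f))"
    by (simp add: lborel.sigma_finite_measure_axioms)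
  then interpret \<nu>: sigma_finite_measure \<nu>
    by (rule sigma_finite_measure_distr) measurable
  interpret pair_sigma_finite lborel \<nu> ..
  have translate: "(\<integral>\<^sup>+ x. g (x + y) \<partial>\<nu>) = (\<integral>\<^sup>+ x. g x \<partial>\<nu>)"
    if [measurable]: "g \<in> borel_measurable borel" for g y
  proof -
    obtain z where y: "y = f z"
      using orthogonal_transformation_surj[OF f] by (auto simp: surj_def)
    have "(\<integral>\<^sup>+ x. g (x + y) \<partial>\<nu>) = (\<integral>\<^sup>+ x. g (f (z + x)) \<partial>lborel)"
      unfolding \<nu>_def y using orthogonal_transformation_linear[OF f]
      by (simp add: nn_integral_distr linear_add add.commute)
    also have "\<dots> = (\<integral>\<^sup>+ x. g (f x) \<partial>distr lborel borel ((+) z))"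
      by (simp add: nn_integral_distr)
    also have "\<dots> = (\<integral>\<^sup>+ x. g x \<partial>\<nu>)"
      unfolding lborel_distr_plus by (simp add: \<nu>_def nn_integral_distr)
    finally show ?thesis .
  qed
  have reflect: "(\<integral>\<^sup>+ y. g (x - y) \<partial>lborel) = (\<integral>\<^sup>+ y. g y \<partial>lborel)"
    if [measurable]: "g \<in> borel_measurable borel" for g and x :: 'a
  proof -
    have "lborel = distr lborel borel (\<lambda>y. x - y)"
      using lborel_affine[of "-1" x] by (simp add: density_1)
    then have "(\<integral>\<^sup>+ y. g y \<partial>lborel) = (\<integral>\<^sup>+ y. g y \<partial>distr lborel borel (\<lambda>y. x - y))"
      by (rule arg_cong[where f = "\<lambda>M. nn_integral M g"])
    then show ?thesis
      by (simp add: nn_integral_distr)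
  qed
  fix A assume "A \<in> sets (distr lborel borel f)"
  then have A [measurable]: "A \<in> sets borel" by simp
  let ?a = "indicator A :: 'a \<Rightarrow> ennreal" and ?b = "indicator ?B :: 'a \<Rightarrow> ennreal"
  have "emeasure \<nu> A * emeasure lborel ?B = (\<integral>\<^sup>+ x. (\<integral>\<^sup>+ y. ?a x * ?b (x - y) \<partial>lborel) \<partial>\<nu>)"
  proof -
    have "(\<integral>\<^sup>+ y. ?a x * ?b (x - y) \<partial>lborel) = ?a x * emeasure lborel ?B" for x
    proof -
      have "(\<integral>\<^sup>+ y. ?a x * ?b (x - y) \<partial>lborel) = ?a x * (\<integral>\<^sup>+ y. ?b (x - y) \<partial>lborel)"
        by (rule nn_integral_cmult) measurable
      also have "(\<integral>\<^sup>+ y. ?b (x - y) \<partial>lborel) = (\<integral>\<^sup>+ y. ?b y \<partial>lborel)"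
        by (rule reflect) measurable
      finally show ?thesis
        by simp
    qed
    then show ?thesis
      by (simp add: nn_integral_multc)
  qed
  also have "\<dots> = (\<integral>\<^sup>+ y. (\<integral>\<^sup>+ x. ?a x * ?b (x - y) \<partial>\<nu>) \<partial>lborel)"
    by (rule Fubini') measurable
  also have "\<dots> = (\<integral>\<^sup>+ y. (\<integral>\<^sup>+ x. ?a (x + y) * ?b x \<partial>\<nu>) \<partial>lborel)"
  proof (rule nn_integral_cong)
    fix y
    show "(\<integral>\<^sup>+ x. ?a x * ?b (x - y) \<partial>\<nu>) = (\<integral>\<^sup>+ x. ?a (x + y) * ?b x \<partial>\<nu>)"
      using translate[of "\<lambda>x. ?a x * ?b (x - y)" y] by simp
  qed
  also have "\<dots> = (\<integral>\<^sup>+ x. (\<integral>\<^sup>+ y. ?a (x + y) * ?b x \<partial>lborel) \<partial>\<nu>)"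
    by (rule Fubini'[symmetric]) measurable
  also have "\<dots> = (\<integral>\<^sup>+ x. emeasure lborel A * ?b x \<partial>\<nu>)"
  proof (rule nn_integral_cong)
    fix x
    have "(\<integral>\<^sup>+ y. ?a (x + y) \<partial>lborel) = (\<integral>\<^sup>+ y. ?a y \<partial>distr lborel borel ((+) x))"
      by (subst nn_integral_distr) simp_all
    also have "\<dots> = emeasure lborel A"
      unfolding lborel_distr_plus by simp
    finally show "(\<integral>\<^sup>+ y. ?a (x + y) * ?b x \<partial>lborel) = emeasure lborel A * ?b x"
      by (simp add: nn_integral_multc)
  qed
  also have "\<dots> = emeasure lborel A * emeasure \<nu> ?B"
    by (simp add: nn_integral_cmult)
  also have "emeasure \<nu> ?B = emeasure lborel ?B"
  proof -
    have "f -` ?B = ?B"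
      using orthogonal_transformation_norm[OF f] by auto
    then show ?thesis
      by (simp add: \<nu>_def emeasure_distr)
  qed
  finally have "emeasure \<nu> A * emeasure lborel ?B / emeasure lborel ?B
      = emeasure lborel A * emeasure lborel ?B / emeasure lborel ?B"
    by simp
  moreover have "c * emeasure lborel ?B / emeasure lborel ?B = c" for c
    using emeasure_unit_ball_nonzero[where 'a = 'a] emeasure_unit_ball_finite[where 'a = 'a]
    by (intro ennreal_mult_divide_eq) (simp_all only: less_top infinity_ennreal_def not_False_eq_True)
  ultimately show "emeasure (distr lborel borel f) A = emeasure lborel A"
    by (simp only: \<nu>_def)
qed simp


lemma uniform_ball_orthogonal_invariant:
  fixes f :: "real^'n \<Rightarrow> real^'n"
  assumes f: "orthogonal_transformation f"
  shows "distr (uniform_measure lborel (ball 0 1)) borel f = uniform_measure lborel (ball 0 1)"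
proof (rule measure_eqI)
  have f_meas [measurable]: "f \<in> borel_measurable borel"
    by (rule orthogonal_transformation_measurable[OF f])
  fix A :: "(real^'n) set" assume "A \<in> sets (distr (uniform_measure lborel (ball 0 1)) borel f)"
  then have A [measurable]: "A \<in> sets borel" by simp
  have pre [measurable]: "f -` A \<in> sets borel"
    using measurable_sets[OF f_meas A] by simp
  have "f -` ball 0 1 = ball 0 1"
    using orthogonal_transformation_norm[OF f] by auto
  then have "emeasure lborel (ball 0 1 \<inter> f -` A) = emeasure (distr lborel borel f) (ball 0 1 \<inter> A)"
    by (simp add: emeasure_distr vimage_Int)
  then have "emeasure lborel (ball 0 1 \<inter> f -` A) = emeasure lborel (ball 0 1 \<inter> A)"
    by (simp add: lborel_distr_orthogonal[OF f])
  then show "emeasure (distr (uniform_measure lborel (ball 0 1)) borel f) A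
      = emeasure (uniform_measure lborel (ball 0 1)) A"
    by (simp add: emeasure_distr)
qed simp

lemma uniform_sphere_orthogonal_invariant:
  fixes f :: "real^'n \<Rightarrow> real^'n"
  assumes f: "orthogonal_transformation f"
  shows "distr uniform_sphere borel f = uniform_sphere"
proof -
  let ?B = "uniform_measure lborel (ball (0::real^'n) 1)"
  have f_meas [measurable]: "f \<in> borel_measurable borel"
    by (rule orthogonal_transformation_measurable[OF f])
  have comm: "f \<circ> sgn = sgn \<circ> f"
    using f by (auto simp: fun_eq_iff sgn_div_norm orthogonal_transformation_norm
        linear_cmul orthogonal_transformation_linear)
  have "distr uniform_sphere borel f = distr ?B borel (f \<circ> sgn)"
    unfolding uniform_sphere_def by (rule distr_distr) measurable
  also have "\<dots> = distr (distr ?B borel f) borel sgn"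
    unfolding comm by (rule distr_distr[symmetric]) measurable
  finally show ?thesis
    by (simp add: uniform_ball_orthogonal_invariant[OF f] uniform_sphere_def)
qed

lemma prob_space_uniform_sphere: "prob_space (uniform_sphere :: (real^'n) measure)"
proof -
  have "prob_space (uniform_measure lborel (ball (0::real^'n) 1))"
    by (intro prob_space_uniform_measure emeasure_unit_ball_nonzero)
       (metis emeasure_unit_ball_finite less_irrefl)
  then show ?thesis
    unfolding uniform_sphere_def by (intro prob_space.prob_space_distr) measurable
qed

lemma sets_uniform_sphere [simp, measurable_cong]: "sets uniform_sphere = sets borel"
  by (simp add: uniform_sphere_def)

lemma space_uniform_sphere [simp]: "space uniform_sphere = UNIV"
  by (simp add: uniform_sphere_def)

lemma uniform_sphere_norm_le_1: "AE u in uniform_sphere. norm u \<le> 1"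
  unfolding uniform_sphere_def by (subst AE_distr_iff) (auto simp: norm_sgn)

text \<open>
  The radial projection maps a point of the ball into the hyperplane only if the point lies
  in the hyperplane itself, which is a null set.
\<close>

lemma uniform_sphere_no_hyperplane:
  fixes p :: "real^'n"
  assumes "p \<noteq> 0"
  shows "\<not> (AE u in uniform_sphere. p \<bullet> u = 0)"
proof
  assume "AE u in uniform_sphere. p \<bullet> u = 0"
  then have "AE x in uniform_measure lborel (ball 0 1). p \<bullet> sgn x = 0"
    unfolding uniform_sphere_def by (subst (asm) AE_distr_iff) simp_all
  then have "AE x in lborel. x \<in> ball 0 1 \<longrightarrow> p \<bullet> sgn x = 0"
    using emeasure_unit_ball by (subst (asm) AE_uniform_measure) auto
  moreover have "AE x in lborel. x \<notin> {x. p \<bullet> x = 0}"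
  proof -
    have "{x. p \<bullet> x = 0} \<in> null_sets lebesgue"
      using negligible_hyperplane[of p 0] assms by (simp add: negligible_iff_null_sets)
    moreover have "{x. p \<bullet> x = 0} \<in> sets lborel"
      by simp
    ultimately show ?thesis
      by (intro AE_not_in) (simp add: null_sets_completion_iff)
  qed
  ultimately have "AE x in lborel. x \<notin> ball (0::real^'n) 1"
    by eventually_elim (auto simp: sgn_div_norm)
  then have "ball (0::real^'n) 1 \<in> null_sets lborel"
    by (subst AE_iff_null_sets) auto
  then show False
    using emeasure_unit_ball_nonzero by blast
qed

text \<open>
  The two variables may take values in different spaces, so independence is given by the
  generated families of events.
\<close>

lemma distr_pair_indep:
  assumes "prob_space N" and [measurable]: "Y \<in> borel_measurable N" "Z \<in> borel_measurable N"
    and indep: "prob_space.indep_set N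
       {Y -` A \<inter> space N |A. A \<in> sets borel} {Z -` A \<inter> space N |A. A \<in> sets borel}"
  shows "distr N borel Y \<Otimes>\<^sub>M distr N borel Z = distr N (borel \<Otimes>\<^sub>M borel) (\<lambda>\<omega>. (Y \<omega>, Z \<omega>))"
proof (rule pair_measure_eqI)
  interpret N: prob_space N by fact
  interpret Y: prob_space "distr N borel Y" by (rule N.prob_space_distr) measurable
  interpret Z: prob_space "distr N borel Z" by (rule N.prob_space_distr) measurable
  show "sigma_finite_measure (distr N borel Y)" "sigma_finite_measure (distr N borel Z)"
    by unfold_locales
  fix A B assume "A \<in> sets (distr N borel Y)" "B \<in> sets (distr N borel Z)"
  then have AB [measurable]: "A \<in> sets borel" "B \<in> sets borel" by simp_all
  have "N.prob ((Y -` A \<inter> space N) \<inter> (Z -` B \<inter> space N))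
      = N.prob (Y -` A \<inter> space N) * N.prob (Z -` B \<inter> space N)"
    using AB by (intro N.indep_setD[OF indep]) blast+
  moreover have "(\<lambda>\<omega>. (Y \<omega>, Z \<omega>)) -` (A \<times> B) \<inter> space N
      = (Y -` A \<inter> space N) \<inter> (Z -` B \<inter> space N)"
    by auto
  ultimately show "emeasure (distr N borel Y) A * emeasure (distr N borel Z) B
      = emeasure (distr N (borel \<Otimes>\<^sub>M borel) (\<lambda>\<omega>. (Y \<omega>, Z \<omega>))) (A \<times> B)"
    by (simp add: emeasure_distr N.emeasure_eq_measure ennreal_mult)
qed simp

lemma stochastic_representationD:
  assumes "stochastic_representation M X \<mu> S N \<xi> U"
  shows "prob_space N" and "\<xi> \<in> borel_measurable N" and "U \<in> borel_measurable N"
    and "prob_space.indep_set N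
       {\<xi> -` A \<inter> space N |A. A \<in> sets borel} {U -` A \<inter> space N |A. A \<in> sets borel}"
    and "distr N borel U = uniform_sphere"
    and "\<exists>R. is_sqrt_matrix R S \<and>
       distr M borel X = distr N borel (\<lambda>\<omega>. \<mu> + \<xi> \<omega> *\<^sub>R (R *v U \<omega>))"
  using assms unfolding stochastic_representation_def by - (elim conjE, assumption)+

lemma stochastic_representation_law:
  assumes "stochastic_representation M X \<mu> S N \<xi> U"
    and law: "distr M borel X = distr N borel (\<lambda>\<omega>. \<mu> + \<xi> \<omega> *\<^sub>R (R *v U \<omega>))"
  shows "distr M borel X = distr (distr N borel \<xi> \<Otimes>\<^sub>M uniform_sphere) borel
           (\<lambda>(r, u). \<mu> + r *\<^sub>R (R *v u))"
proof -
  note [measurable] = stochastic_representationD(2,3)[OF assms(1)]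
  show ?thesis
    unfolding law stochastic_representationD(5)[OF assms(1), symmetric]
      distr_pair_indep[OF stochastic_representationD(1-4)[OF assms(1)]]
    by (subst distr_distr) (auto simp: comp_def)
qed

lemma orthogonal_reflection:
  fixes p :: "'a::real_inner"
  shows "orthogonal_transformation (\<lambda>u. u - (2 * (p \<bullet> u) / (p \<bullet> p)) *\<^sub>R p)"
  unfolding orthogonal_transformation_def
proof (intro conjI allI)
  define c where "c = 2 / (p \<bullet> p)"
  have c: "2 * (p \<bullet> u) / (p \<bullet> p) = c * (p \<bullet> u)" for u
    by (simp add: c_def)
  show "linear (\<lambda>u. u - (2 * (p \<bullet> u) / (p \<bullet> p)) *\<^sub>R p)"
    unfolding c by (rule linearI) (simp_all add: inner_add_right algebra_simps)
  fix v w
  have eq: "(v - (c * (p \<bullet> v)) *\<^sub>R p) \<bullet> (w - (c * (p \<bullet> w)) *\<^sub>R p)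
      = v \<bullet> w + (p \<bullet> v) * (p \<bullet> w) * (c * (c * (p \<bullet> p) - 2))"
    by (simp add: inner_diff_left inner_diff_right inner_commute[of v p] algebra_simps)
  have "c * (c * (p \<bullet> p) - 2) = 0"
    by (simp add: c_def)
  then show "(v - (2 * (p \<bullet> v) / (p \<bullet> p)) *\<^sub>R p) \<bullet> (w - (2 * (p \<bullet> w) / (p \<bullet> p)) *\<^sub>R p) = v \<bullet> w"
    unfolding c eq by simp
qed

text \<open>
  Under \<open>(r, u) \<mapsto> \<mu> + r R u\<close> the reflection of \<open>X\<close> corresponds to a Euclidean reflection of \<open>u\<close>
  alone, which preserves the product measure.
\<close>

lemma elliptical_reflection:
  fixes X :: "'a \<Rightarrow> real^'n"
  assumes X [measurable]: "X \<in> borel_measurable M"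
    and R: "is_sqrt_matrix R S" and D: "sets D = sets borel" "prob_space D"
    and law: "distr M borel X = distr (D \<Otimes>\<^sub>M uniform_sphere) borel (\<lambda>(r, u). \<mu> + r *\<^sub>R (R *v u))"
  shows "distr M borel (\<lambda>\<omega>. covariance_reflection \<mu> S q (X \<omega>)) = distr M borel X"
proof -
  note [measurable_cong] = D(1)
  define p where "p = R *v q"
  define f where "f = (\<lambda>u. u - (2 * (p \<bullet> u) / (p \<bullet> p)) *\<^sub>R p)"
  define g where "g = (\<lambda>(r :: real, u). \<mu> + r *\<^sub>R (R *v u))"
  let ?T = "covariance_reflection \<mu> S q"
  let ?P = "D \<Otimes>\<^sub>M (uniform_sphere :: (real^'n) measure)"
  have f: "orthogonal_transformation f"
    unfolding f_def by (rule orthogonal_reflection)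
  have [measurable]: "f \<in> borel_measurable borel"
    by (rule orthogonal_transformation_measurable[OF f])
  have g [measurable]: "g \<in> borel_measurable ?P"
    unfolding g_def by measurable
  have R': "R *v p = S *v q" "x \<bullet> (R *v y) = (R *v x) \<bullet> y" for x y
    using R positive_definite_inner_commute[of R]
    unfolding is_sqrt_matrix_def p_def by (auto simp: matrix_vector_mul_assoc)
  have Sq: "q \<bullet> (S *v q) = p \<bullet> p"
    unfolding R'(1)[symmetric] R'(2) by (simp add: p_def)
  have Tg: "?T (g (r, u)) = g (r, f u)" for r u
    unfolding covariance_reflection_def g_def f_def Sq R'(1)[symmetric]
    by (simp add: R'(2) p_def[symmetric] matrix_vector_mult_diff_distrib algebra_simps
        matrix_vector_mult_scaleR)
  have "distr M borel (\<lambda>\<omega>. ?T (X \<omega>)) = distr (distr M borel X) borel ?T"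
    by (subst distr_distr) (auto simp: comp_def)
  also have "\<dots> = distr ?P borel (?T \<circ> g)"
    unfolding law g_def[symmetric] by (rule distr_distr) measurable
  also have "?T \<circ> g = g \<circ> (\<lambda>(r, u). (r, f u))"
    by (auto simp: Tg)
  also have "distr ?P borel \<dots> = distr (distr ?P ?P (\<lambda>(r, u). (r, f u))) borel g"
    by (rule distr_distr[symmetric]) measurable
  also have "distr ?P ?P (\<lambda>(r, u). (r, f u)) = distr D D (\<lambda>r. r) \<Otimes>\<^sub>M distr uniform_sphere uniform_sphere f"
  proof (rule pair_measure_distr[symmetric])
    have "prob_space (distr uniform_sphere uniform_sphere f)"
      by (rule prob_space.prob_space_distr[OF prob_space_uniform_sphere]) measurable
    then show "sigma_finite_measure (distr uniform_sphere uniform_sphere f)"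
      by (simp add: prob_space_imp_sigma_finite)
  qed measurable
  also have "distr D D (\<lambda>r. r) = D"
    by (rule distr_id)
  also have "distr uniform_sphere uniform_sphere f = distr uniform_sphere borel f"
    by (rule distr_cong) simp_all
  also have "\<dots> = uniform_sphere"
    by (rule uniform_sphere_orthogonal_invariant[OF f])
  finally show ?thesis
    unfolding law g_def .
qed

lemma stochastic_representation_square_integrable:
  fixes X :: "'a \<Rightarrow> real^'n"
  assumes rep: "stochastic_representation M X \<mu> S N \<xi> U"
    and X [measurable]: "X \<in> borel_measurable M"
    and law: "distr M borel X = distr N borel (\<lambda>\<omega>. \<mu> + \<xi> \<omega> *\<^sub>R (R *v U \<omega>))"
    and int: "integrable N (\<lambda>\<omega>. (\<xi> \<omega>)\<^sup>2)"
  shows "integrable M (\<lambda>\<omega>. (norm (X \<omega> - \<mu>))\<^sup>2)"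
proof -
  note [measurable] = stochastic_representationD(2,3)[OF rep]
  obtain B where B: "B > 0" "\<And>x. norm (R *v x) \<le> norm x * B"
    using bounded_linear.pos_bounded[OF matrix_vector_mul_bounded_linear[of R]] by blast
  have "AE u in distr N borel U. norm u \<le> 1"
    unfolding stochastic_representationD(5)[OF rep] by (rule uniform_sphere_norm_le_1)
  then have "AE \<omega> in N. norm (U \<omega>) \<le> 1"
    by (subst (asm) AE_distr_iff) simp_all
  then have bound: "AE \<omega> in N. norm ((norm (\<xi> \<omega> *\<^sub>R (R *v U \<omega>)))\<^sup>2) \<le> norm (B\<^sup>2 * (\<xi> \<omega>)\<^sup>2)"
  proof eventually_elim
    case (elim \<omega>)
    have "norm (R *v U \<omega>) \<le> norm (U \<omega>) * B"
      by (rule B(2))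
    also have "\<dots> \<le> B"
      using elim B(1) by (simp add: mult_left_le_one_le)
    finally have "(norm (R *v U \<omega>))\<^sup>2 \<le> B\<^sup>2"
      by (intro power_mono) simp_all
    then have "(\<xi> \<omega>)\<^sup>2 * (norm (R *v U \<omega>))\<^sup>2 \<le> (\<xi> \<omega>)\<^sup>2 * B\<^sup>2"
      by (intro mult_left_mono) simp_all
    then show ?case
      by (simp add: power_mult_distrib abs_mult mult.commute)
  qed
  have "integrable N (\<lambda>\<omega>. (norm (\<xi> \<omega> *\<^sub>R (R *v U \<omega>)))\<^sup>2)"
    by (rule Bochner_Integration.integrable_bound[OF _ _ bound]) (use int in auto)
  then have "integrable (distr N borel (\<lambda>\<omega>. \<mu> + \<xi> \<omega> *\<^sub>R (R *v U \<omega>))) (\<lambda>x. (norm (x - \<mu>))\<^sup>2)"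
    by (subst integrable_distr_eq) simp_all
  then show ?thesis
    unfolding law[symmetric] by (subst (asm) integrable_distr_eq) simp_all
qed

text \<open>
  Since \<open>q \<bullet> (X - \<mu>)\<close> is distributed as the product of the radius and \<open>(R *v q) \<bullet> u\<close>, and the second
  factor is almost surely nonzero on the sphere, it can vanish almost surely only if the radius does.
\<close>

lemma elliptical_nondegenerate:
  fixes X :: "'a \<Rightarrow> real^'n"
  assumes X [measurable]: "X \<in> borel_measurable M"
    and R: "positive_definite R" and D: "sets D = sets borel" "prob_space D"
    and law: "distr M borel X = distr (D \<Otimes>\<^sub>M uniform_sphere) borel (\<lambda>(r, u). \<mu> + r *\<^sub>R (R *v u))"
    and nz: "\<not> (AE r in D. r = 0)" and q: "q \<noteq> 0"
  shows "\<not> (AE \<omega> in M. q \<bullet> (X \<omega> - \<mu>) = 0)"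
proof
  note [measurable_cong] = D(1)
  let ?P = "D \<Otimes>\<^sub>M (uniform_sphere :: (real^'n) measure)"
  interpret D: prob_space D by fact
  interpret sphere: prob_space "uniform_sphere :: (real^'n) measure"
    by (rule prob_space_uniform_sphere)
  interpret pair_sigma_finite D "uniform_sphere :: (real^'n) measure" ..
  have Rq: "R *v q \<noteq> 0"
    using positive_definite_ker[OF R] q by blast
  assume "AE \<omega> in M. q \<bullet> (X \<omega> - \<mu>) = 0"
  then have "AE x in distr M borel X. q \<bullet> (x - \<mu>) = 0"
    by (subst AE_distr_iff) simp_all
  then have "AE z in ?P. q \<bullet> ((case z of (r, u) \<Rightarrow> \<mu> + r *\<^sub>R (R *v u)) - \<mu>) = 0"
    unfolding law by (subst (asm) AE_distr_iff) simp_all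
  then have "AE r in D. AE u in uniform_sphere. r * ((R *v q) \<bullet> u) = 0"
    using positive_definite_inner_commute[OF R] by (auto dest!: AE_pair)
  then have "AE r in D. r = 0"
  proof eventually_elim
    case (elim r)
    show ?case
    proof (rule ccontr)
      assume "r \<noteq> 0"
      with elim have "AE u in uniform_sphere. (R *v q) \<bullet> u = 0"
        by simp
      then show False
        using uniform_sphere_no_hyperplane[OF Rq] by blast
    qed
  qed
  with nz show False ..
qed

lemma elliptical_reflection_invariant:
  fixes X :: "'a \<Rightarrow> real^'n"
  assumes S: "positive_definite S"
    and rep: "stochastic_representation M X \<mu> S N \<xi> U"
    and int: "integrable N (\<lambda>\<omega>. (\<xi> \<omega>)\<^sup>2)"
    and pos: "0 < (LINT \<omega>|N. (\<xi> \<omega>)\<^sup>2)"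
    and M: "prob_space M" and X: "X \<in> borel_measurable M"
  shows "reflection_invariant M X \<mu> S"
proof -
  obtain R where R: "is_sqrt_matrix R S"
    and law_N: "distr M borel X = distr N borel (\<lambda>\<omega>. \<mu> + \<xi> \<omega> *\<^sub>R (R *v U \<omega>))"
    using stochastic_representationD(6)[OF rep] by blast
  note N = stochastic_representationD(1)[OF rep] and \<xi> = stochastic_representationD(2)[OF rep]
  let ?D = "distr N borel \<xi>"
  have D: "sets ?D = sets borel" "prob_space ?D"
    using N \<xi> by (auto intro: prob_space.prob_space_distr)
  have nz: "\<not> (AE r in ?D. r = 0)"
  proof
    assume "AE r in ?D. r = 0"
    then have "AE \<omega> in N. \<xi> \<omega> = 0"
      using \<xi> by (subst (asm) AE_distr_iff) auto
    then have "AE \<omega> in N. (\<xi> \<omega>)\<^sup>2 = 0"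
      by eventually_elim simp
    then have "(LINT \<omega>|N. (\<xi> \<omega>)\<^sup>2) = 0"
      by (rule integral_eq_zero_AE)
    with pos show False by simp
  qed
  note law = stochastic_representation_law[OF rep law_N]
  show ?thesis
    unfolding reflection_invariant_def reflection_invariant_axioms_def
  proof (intro conjI allI impI)
    show "integrable M (\<lambda>\<omega>. (norm (X \<omega> - \<mu>))\<^sup>2)"
      by (rule stochastic_representation_square_integrable[OF rep X law_N int])
    show "distr M borel (\<lambda>\<omega>. covariance_reflection \<mu> S q (X \<omega>)) = distr M borel X" for q
      by (rule elliptical_reflection[OF X R D law])
    show "\<not> (AE \<omega> in M. q \<bullet> (X \<omega> - \<mu>) = 0)" if "q \<noteq> 0" for q
      using R that unfolding is_sqrt_matrix_def
      by (intro elliptical_nondegenerate[OF X _ D law nz]) auto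
  qed (use S M X in auto)
qed

section \<open>Positive elliptical distributions are partially faithful\<close>

theorem proposition4p15:
  fixes M :: "'a measure" and X :: "'a \<Rightarrow> real^'n"
    and \<mu> :: "real^'n" and S :: "real^'n^'n"
    and N :: "'b measure" and \<xi> :: "'b \<Rightarrow> real" and U :: "'b \<Rightarrow> real^'n"
  assumes "positive_definite S"
    and "stochastic_representation M X \<mu> S N \<xi> U"
    and "integrable N (\<lambda>\<omega>. (\<xi> \<omega>)\<^sup>2)"
    and "0 < (LINT \<omega>|N. (\<xi> \<omega>)\<^sup>2)"
    and "positive_elliptical M X \<mu> S"
  shows "partially_faithful M X"
  unfolding partially_faithful_def
proof (intro allI impI)
  fix i j :: 'n and C :: "'n set"
  assume ij: "i \<noteq> j" and C: "C \<subseteq> UNIV - {i, j}" and uncorr: "cond_uncorrelated M X i j C"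
  have "prob_space M" "X \<in> borel_measurable M"
    using assms(5) unfolding positive_elliptical_def elliptical_def by - (elim conjE, assumption)+
  then interpret reflection_invariant M X \<mu> S
    by (rule elliptical_reflection_invariant[OF assms(1-4)])
  obtain R where R: "is_sqrt_matrix R S"
    using stochastic_representationD(6)[OF assms(2)] by blast
  have off: "matrix_inv S $ k $ l \<le> 0" if "k \<noteq> l" for k l
    by (rule partial_correlation_nonneg_imp[OF assms(1)])
       (use assms(5) that in \<open>simp add: positive_elliptical_def\<close>)
  have iC: "i \<notin> C" and jC: "j \<notin> C"
    using C by auto
  obtain q where q: "residual_direction S C i q"
    by (rule residual_direction_exists[OF R iC])
  obtain r where r: "residual_direction S C j r"
    by (rule residual_direction_exists[OF R jC])
  have zero: "(S *v r) $ i = 0"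
    using uncorr cond_uncorrelated_iff[OF q iC r jC] residual_direction_inner[OF q iC r] by simp
  have K: "matrix_inv S $ i $ j = 0"
    by (rule residual_covariance_zero_imp_precision_zero[OF assms(1) off r iC jC ij zero])
  let ?E = "UNIV - {i, j}"
  have iE: "i \<notin> ?E" and jE: "j \<notin> ?E"
    by auto
  obtain q' where q': "residual_direction S ?E i q'"
    by (rule residual_direction_exists[OF R iE])
  obtain r' where r': "residual_direction S ?E j r'"
    by (rule residual_direction_exists[OF R jE])
  have "(S *v r') $ i = 0"
    by (rule precision_zero_imp_residual_covariance_zero[OF assms(1) r' ij K])
  then show "cond_uncorrelated M X i j ?E"
    using cond_uncorrelated_iff[OF q' iE r' jE] residual_direction_inner[OF q' iE r'] by simp
qed

end
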